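(* (Identity Principle) Let $N\ge 1$ and let $f$ and $g$ be two slice polyanalytic functions of order $N$ on an axially symmetric slice domain $\Omega\subset\mathbb{H}$. If, for some $I\in\mathbb{S}$, $f$ and $g$ coincide on a subdomain $U$ of $\Omega_I$, then $f=g$ everywhere in $\Omega$.
   Context: $\mathbb{H}$ denotes the quaternions, $\mathbb{S}=\{q\in\mathbb{H}: q^2=-1\}$, and for $I\in\mathbb{S}$, $\mathbb{C}_I=\mathbb{R}+\mathbb{R}I$. For $\Omega\subset\mathbb{H}$ put $\Omega_I=\Omega\cap\mathbb{C}_I$. An open set $\Omega$ is axially symmetric if $x+Iy\in\Omega$ implies $x+Jy\in\Omega$ for all $J\in\mathbb{S}$. A domain (nonempty connected open set) $\Omega\subset\mathbb{H}$ is a slice domain if $\Omega\cap\mathbb{R}\neq\emptyset$ and $\Omega_I$ is a domain of $\mathbb{C}_I$ for every $I\in\mathbb{S}$. A subdomain of $\Omega_I$ is a nonempty connected open subset of $\Omega_I$ (open in $\mathbb{C}_I$). Slice polyanalytic functions: let $\Omega$ be an axially symmetric open set and $\mathcal{U}=\{(x,y)\in\mathbb{R}^2: x+Iy\in\Omega \text{ for all } I\in\mathbb{S}\}$. A function $f:\Omega\to\mathbb{H}$ is a (left) slice function if $f(x+Iy)=\alpha(x,y)+I\beta(x,y)$ for all $x+Iy\in\Omega$, $I\in\mathbb{S}$, where $\alpha,\beta:\mathcal{U}\to\mathbb{H}$ do not depend on $I$ and satisfy $\alpha(x,-y)=\alpha(x,y)$, $\beta(x,-y)=-\beta(x,y)$.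 If moreover $\alpha,\beta$ are of class $\mathcal{C}^N$ and $\frac{1}{2^N}(\partial_x+I\partial_y)^N(\alpha(x,y)+I\beta(x,y))=0$ for all $I\in\mathbb{S}$, then $f$ is called (left) slice polyanalytic of order $N$. *)

theory Defs
  imports "HOL-Analysis.Analysis"
begin

section \<open>The quaternions\<close>

datatype quat = Quat (qRe: real) (qI: real) (qJ: real) (qK: real)

lemma quat_eq_iff:
  "p = q \<longleftrightarrow> qRe p = qRe q \<and> qI p = qI q \<and> qJ p = qJ q \<and> qK p = qK q"
  by (cases p; cases q) auto

instantiation quat :: real_vector
begin

definition "0 = Quat 0 0 0 0"
definition "p + q = Quat (qRe p + qRe q) (qI p + qI q) (qJ p + qJ q) (qK p + qK q)"
definition "p - q = Quat (qRe p - qRe q) (qI p - qI q) (qJ p - qJ q) (qK p - qK q)"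
definition "- q = Quat (- qRe q) (- qI q) (- qJ q) (- qK q)"
definition "r *\<^sub>R q = Quat (r * qRe q) (r * qI q) (r * qJ q) (r * qK q)"

instance
  by standard
    (simp_all add: quat_eq_iff zero_quat_def plus_quat_def minus_quat_def uminus_quat_def
      scaleR_quat_def algebra_simps)

end

lemma quat_sel_linear [simp]:
  "qRe 0 = 0" "qI 0 = 0" "qJ 0 = 0" "qK 0 = 0"
  "qRe (p + q) = qRe p + qRe q" "qI (p + q) = qI p + qI q"
  "qJ (p + q) = qJ p + qJ q" "qK (p + q) = qK p + qK q"
  "qRe (p - q) = qRe p - qRe q" "qI (p - q) = qI p - qI q"
  "qJ (p - q) = qJ p - qJ q" "qK (p - q) = qK p - qK q"
  "qRe (- q) = - qRe q" "qI (- q) = - qI q" "qJ (- q) = - qJ q" "qK (- q) = - qK q"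
  "qRe (r *\<^sub>R q) = r * qRe q" "qI (r *\<^sub>R q) = r * qI q"
  "qJ (r *\<^sub>R q) = r * qJ q" "qK (r *\<^sub>R q) = r * qK q"
  by (simp_all add: zero_quat_def plus_quat_def minus_quat_def uminus_quat_def scaleR_quat_def)

instantiation quat :: real_inner
begin

definition inner_quat :: "quat \<Rightarrow> quat \<Rightarrow> real" where
  "inner_quat p q = qRe p * qRe q + qI p * qI q + qJ p * qJ q + qK p * qK q"
definition norm_quat :: "quat \<Rightarrow> real" where
  "norm_quat q = sqrt ((qRe q)\<^sup>2 + (qI q)\<^sup>2 + (qJ q)\<^sup>2 + (qK q)\<^sup>2)"
definition sgn_quat :: "quat \<Rightarrow> quat" where
  "sgn_quat q = q /\<^sub>R norm q"
definition dist_quat :: "quat \<Rightarrow> quat \<Rightarrow> real" where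
  "dist_quat p q = norm (p - q)"
definition uniformity_quat :: "(quat \<times> quat) filter" where
  "uniformity_quat = (INF e\<in>{0 <..}. principal {(p, q). dist p q < e})"
definition open_quat :: "quat set \<Rightarrow> bool" where
  "open_quat U \<longleftrightarrow> (\<forall>p\<in>U. \<forall>\<^sub>F (p', q) in uniformity. p' = p \<longrightarrow> q \<in> U)"

instance
proof
  fix p q s :: quat and r :: real and U :: "quat set"
  show "dist p q = norm (p - q)" "sgn q = q /\<^sub>R norm q"
    "uniformity = (INF e\<in>{0 <..}. principal {(p :: quat, q). dist p q < e})"
    "open U \<longleftrightarrow> (\<forall>p\<in>U. \<forall>\<^sub>F (p', q) in uniformity. p' = p \<longrightarrow> q \<in> U)"
    by (fact dist_quat_def sgn_quat_def uniformity_quat_def open_quat_def)+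
  show "inner p q = inner q p" "inner (p + q) s = inner p s + inner q s"
    "inner (r *\<^sub>R p) q = r * inner p q" "0 \<le> inner p p" "norm p = sqrt (inner p p)"
    by (simp_all add: inner_quat_def norm_quat_def algebra_simps power2_eq_square)
  show "inner p p = 0 \<longleftrightarrow> p = 0"
    by (simp add: inner_quat_def quat_eq_iff add_nonneg_eq_0_iff)
qed

end

instantiation quat :: real_normed_div_algebra
begin

definition one_quat :: quat where
  "1 = Quat 1 0 0 0"
definition times_quat :: "quat \<Rightarrow> quat \<Rightarrow> quat" where
  "p * q = Quat
     (qRe p * qRe q - qI p * qI q - qJ p * qJ q - qK p * qK q)
     (qRe p * qI q + qI p * qRe q + qJ p * qK q - qK p * qJ q)
     (qRe p * qJ q - qI p * qK q + qJ p * qRe q + qK p * qI q)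
     (qRe p * qK q + qI p * qJ q - qJ p * qI q + qK p * qRe q)"
definition inverse_quat :: "quat \<Rightarrow> quat" where
  "inverse q = Quat (qRe q) (- qI q) (- qJ q) (- qK q) /\<^sub>R (norm q)\<^sup>2"
definition divide_quat :: "quat \<Rightarrow> quat \<Rightarrow> quat" where
  "divide_quat p q = p * inverse q"

instance
proof
  fix p q s :: quat and r :: real
  have sq: "(norm x)\<^sup>2 = (qRe x)\<^sup>2 + (qI x)\<^sup>2 + (qJ x)\<^sup>2 + (qK x)\<^sup>2" for x :: quat
    by (simp add: norm_quat_def)
  show "p * q * s = p * (q * s)" "(p + q) * s = p * s + q * s" "p * (q + s) = p * q + p * s"
    "r *\<^sub>R p * q = r *\<^sub>R (p * q)" "p * r *\<^sub>R q = r *\<^sub>R (p * q)"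
    by (simp_all add: times_quat_def quat_eq_iff algebra_simps)
  show "1 * p = p" "p * 1 = p" "(0 :: quat) \<noteq> 1"
    by (simp_all add: times_quat_def one_quat_def quat_eq_iff)
  show "p div q = p * inverse q" "inverse (0 :: quat) = 0"
    by (simp_all add: divide_quat_def inverse_quat_def)
  show "inverse q * q = 1" "q * inverse q = 1" if "q \<noteq> 0"
  proof -
    define c where "c = Quat (qRe q) (- qI q) (- qJ q) (- qK q)"
    have "c * q = (norm q)\<^sup>2 *\<^sub>R 1" "q * c = (norm q)\<^sup>2 *\<^sub>R 1"
      unfolding sq by (simp_all add: c_def times_quat_def one_quat_def quat_eq_iff power2_eq_square)
    moreover have "inverse q * q = (c * q) /\<^sub>R (norm q)\<^sup>2" "q * inverse q = (q * c) /\<^sub>R (norm q)\<^sup>2"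
      unfolding inverse_quat_def c_def [symmetric]
      by (simp_all add: times_quat_def quat_eq_iff algebra_simps)
    ultimately show "inverse q * q = 1" "q * inverse q = 1"
      using that by simp_all
  qed
  have "(norm (p * q))\<^sup>2 = (norm p * norm q)\<^sup>2"
    unfolding power_mult_distrib sq times_quat_def quat.sel by algebra
  then show "norm (p * q) = norm p * norm q"
    by (metis norm_ge_zero mult_nonneg_nonneg power2_eq_imp_eq)
qed

end

instantiation quat :: euclidean_space
begin

definition Basis_quat :: "quat set" where
  "Basis = {Quat 1 0 0 0, Quat 0 1 0 0, Quat 0 0 1 0, Quat 0 0 0 1}"

instance
proof
  fix p q :: quat
  show "(Basis :: quat set) \<noteq> {}" "finite (Basis :: quat set)"
    by (simp_all add: Basis_quat_def)
  show "inner p q = (if p = q then 1 else 0)" if "p \<in> Basis" "q \<in> Basis"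
    using that unfolding Basis_quat_def by (elim insertE emptyE) (simp_all add: inner_quat_def)
  show "(\<forall>u\<in>Basis. inner p u = 0) \<longleftrightarrow> p = 0"
    unfolding quat_eq_iff [of p] by (simp add: Basis_quat_def inner_quat_def)
qed

end


section \<open>Slices and slice domains\<close>

definition imag_units :: "quat set" where
  "imag_units = {q. q\<^sup>2 = -1}"

definition slice_plane :: "quat \<Rightarrow> quat set" where
  "slice_plane I = {of_real x + I * of_real y | x y. True}"

definition slice :: "quat set \<Rightarrow> quat \<Rightarrow> quat set" where
  "slice \<Omega> I = \<Omega> \<inter> slice_plane I"

definition axially_symmetric :: "quat set \<Rightarrow> bool" where
  "axially_symmetric \<Omega> \<longleftrightarrow>
     (\<forall>x y. \<forall>I\<in>imag_units. \<forall>J\<in>imag_units.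
        of_real x + I * of_real y \<in> \<Omega> \<longrightarrow> of_real x + J * of_real y \<in> \<Omega>)"

definition domain_in :: "'a::topological_space set \<Rightarrow> 'a set \<Rightarrow> bool" where
  "domain_in X D \<longleftrightarrow> D \<noteq> {} \<and> connected D \<and> openin (top_of_set X) D"

definition slice_domain :: "quat set \<Rightarrow> bool" where
  "slice_domain \<Omega> \<longleftrightarrow> domain_in UNIV \<Omega> \<and> \<Omega> \<inter> \<real> \<noteq> {} \<and>
     (\<forall>I\<in>imag_units. domain_in (slice_plane I) (slice \<Omega> I))"


section \<open>Functions of class \<open>C\<^sup>k\<close> of two real variables\<close>

definition partial_x :: "(real \<times> real \<Rightarrow> 'a::real_normed_vector) \<Rightarrow> real \<times> real \<Rightarrow> 'a" where
  "partial_x F = (\<lambda>(x, y). vector_derivative (\<lambda>t. F (t, y)) (at x))"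

definition partial_y :: "(real \<times> real \<Rightarrow> 'a::real_normed_vector) \<Rightarrow> real \<times> real \<Rightarrow> 'a" where
  "partial_y F = (\<lambda>(x, y). vector_derivative (\<lambda>t. F (x, t)) (at y))"

text \<open>All iterated partial derivatives of order at most \<open>k\<close> exist and are continuous on \<open>S\<close>;
  intended for open \<open>S\<close> only, since the partial derivatives are two-sided.\<close>

primrec Ck_on :: "nat \<Rightarrow> (real \<times> real) set \<Rightarrow> (real \<times> real \<Rightarrow> 'a::real_normed_vector) \<Rightarrow> bool" where
  "Ck_on 0 S F \<longleftrightarrow> continuous_on S F"
| "Ck_on (Suc k) S F \<longleftrightarrow> continuous_on S F \<and>
     (\<forall>(x, y)\<in>S. (\<lambda>t. F (t, y)) differentiable at x \<and> (\<lambda>t. F (x, t)) differentiable at y) \<and>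
     Ck_on k S (partial_x F) \<and> Ck_on k S (partial_y F)"


section \<open>Slice polyanalytic functions\<close>

definition param_set :: "quat set \<Rightarrow> (real \<times> real) set" where
  "param_set \<Omega> = {(x, y). \<forall>I\<in>imag_units. of_real x + I * of_real y \<in> \<Omega>}"

text \<open>The components \<open>\<alpha>\<close> and \<open>\<beta>\<close> are total functions here, but only their values on
  \<^term>\<open>param_set \<Omega>\<close> are constrained.\<close>

definition slice_components ::
  "quat set \<Rightarrow> (quat \<Rightarrow> quat) \<Rightarrow> (real \<times> real \<Rightarrow> quat) \<Rightarrow> (real \<times> real \<Rightarrow> quat) \<Rightarrow> bool" where
  "slice_components \<Omega> f \<alpha> \<beta> \<longleftrightarrow>
     (\<forall>x y. \<forall>I\<in>imag_units. of_real x + I * of_real y \<in> \<Omega> \<longrightarrow>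
        f (of_real x + I * of_real y) = \<alpha> (x, y) + I * \<beta> (x, y)) \<and>
     (\<forall>(x, y)\<in>param_set \<Omega>. \<alpha> (x, -y) = \<alpha> (x, y) \<and> \<beta> (x, -y) = - \<beta> (x, y))"

definition cauchy_riemann_op ::
  "quat \<Rightarrow> (real \<times> real \<Rightarrow> quat) \<Rightarrow> real \<times> real \<Rightarrow> quat" where
  "cauchy_riemann_op I F = (\<lambda>p. partial_x F p + I * partial_y F p)"

definition slice_polyanalytic :: "nat \<Rightarrow> quat set \<Rightarrow> (quat \<Rightarrow> quat) \<Rightarrow> bool" where
  "slice_polyanalytic N \<Omega> f \<longleftrightarrow>
     (\<exists>\<alpha> \<beta>. slice_components \<Omega> f \<alpha> \<beta> \<and>
        Ck_on N (param_set \<Omega>) \<alpha> \<and> Ck_on N (param_set \<Omega>) \<beta> \<and>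
        (\<forall>I\<in>imag_units. \<forall>p\<in>param_set \<Omega>.
           (1 / 2 ^ N) *\<^sub>R (cauchy_riemann_op I ^^ N) (\<lambda>p. \<alpha> p + I * \<beta> p) p = 0))"

end

theory Submission
  imports Defs "HOL-Complex_Analysis.Complex_Analysis"
begin

text \<open>Write \<open>F = \<alpha> + I \<beta>\<close> for the restriction of a slice polyanalytic function to the slice of \<open>I\<close>,
  seen as a function of \<open>(x, y)\<close> on the open connected planar set \<^term>\<open>param_set \<Omega>\<close>.
  The identity principle for the equation \<open>(\<partial>\<^sub>x + I \<partial>\<^sub>y)\<^sup>N F = 0\<close> reduces to the case \<open>N = 1\<close>: two
  solutions \<open>F\<close>, \<open>G\<close> that agree on an open set have images under \<open>\<partial>\<^sub>x + I \<partial>\<^sub>y\<close> that agree there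
  and solve the equation of order \<open>N - 1\<close>, so by induction these images agree everywhere and
  \<open>F - G\<close> solves the equation of order one.

  In order one, the real-linear map \<open>\<phi>(q) = \<langle>q, v\<rangle> - \<i> \<langle>I q, v\<rangle>\<close> turns left multiplication by \<open>I\<close>
  into multiplication by \<open>\<i>\<close>, so it sends solutions to holomorphic functions, to which analytic
  continuation applies. The real part of \<open>\<phi>(q)\<close> is \<open>\<langle>q, v\<rangle>\<close>; as \<open>v\<close> is arbitrary, all of \<open>F - G\<close>
  vanishes.

  Finally, equality on a single slice determines \<open>\<alpha>\<close> and \<open>\<beta>\<close>: the parity conditions turn the
  values at \<open>(x, y)\<close> and \<open>(x, -y)\<close> into \<open>\<alpha> + I \<beta>\<close> and \<open>\<alpha> - I \<beta>\<close>. Hence the functions agree on all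
  slices, and the slices cover \<open>\<Omega>\<close>.\<close>

section \<open>Functions of class \<open>C\<^sup>k\<close> on open sets\<close>

lemma partials_cong:
  fixes F G :: "real \<times> real \<Rightarrow> 'a::real_normed_vector"
  assumes "open S" and "\<And>p. p \<in> S \<Longrightarrow> F p = G p" and "(x, y) \<in> S"
  shows "partial_x F (x, y) = partial_x G (x, y)"
    and "partial_y F (x, y) = partial_y G (x, y)"
    and "(\<lambda>t. F (t, y)) differentiable at x \<longleftrightarrow> (\<lambda>t. G (t, y)) differentiable at x"
    and "(\<lambda>t. F (x, t)) differentiable at y \<longleftrightarrow> (\<lambda>t. G (x, t)) differentiable at y"
proof -
  have "open ((\<lambda>t. (t, y)) -` S)" "open ((\<lambda>t. (x, t)) -` S)"
    by (auto intro!: open_vimage assms continuous_intros)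
  then have "\<forall>\<^sub>F t in nhds x. (t, y) \<in> S" "\<forall>\<^sub>F t in nhds y. (x, t) \<in> S"
    using assms(3) by (auto simp: eventually_nhds)
  then have ev: "\<forall>\<^sub>F t in nhds x. F (t, y) = G (t, y)" "\<forall>\<^sub>F t in nhds y. F (x, t) = G (x, t)"
    using assms(2) by (auto elim: eventually_mono)
  show "partial_x F (x, y) = partial_x G (x, y)" "partial_y F (x, y) = partial_y G (x, y)"
    using ev by (auto simp: partial_x_def partial_y_def intro!: vector_derivative_cong_eq)
  have "f differentiable at a \<Longrightarrow> g differentiable at a"
    if "\<forall>\<^sub>F t in nhds a. f t = g t" for f g :: "real \<Rightarrow> 'a" and a
    using that unfolding differentiable_def
    by (auto intro: has_derivative_transform_eventually
        dest: eventually_nhds_x_imp_x simp: eventually_nhds_conv_at)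
  note this[OF ev(1)] this[OF ev(2)] this[of "\<lambda>t. G (t, y)" "\<lambda>t. F (t, y)" x]
    this[of "\<lambda>t. G (x, t)" "\<lambda>t. F (x, t)" y]
  then show "(\<lambda>t. F (t, y)) differentiable at x \<longleftrightarrow> (\<lambda>t. G (t, y)) differentiable at x"
    "(\<lambda>t. F (x, t)) differentiable at y \<longleftrightarrow> (\<lambda>t. G (x, t)) differentiable at y"
    using ev by (auto simp: eq_commute)
qed

lemma Ck_on_cong:
  assumes "open S" and "\<And>p. p \<in> S \<Longrightarrow> F p = G p" and "Ck_on k S F"
  shows "Ck_on k S G"
  using assms(2,3)
proof (induction k arbitrary: F G)
  case 0
  then show ?case by (simp cong: continuous_on_cong)
next
  case (Suc k)
  have "continuous_on S G"
    using Suc.prems by (simp cong: continuous_on_cong)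
  moreover have "Ck_on k S (partial_x G)" "Ck_on k S (partial_y G)"
    using Suc.prems partials_cong[OF assms(1), of F G]
    by (auto intro!: Suc.IH[of "partial_x F" "partial_x G"] Suc.IH[of "partial_y F" "partial_y G"])
  ultimately show ?case
    using Suc.prems partials_cong(3,4)[OF assms(1), of F G] by fastforce
qed

lemma partials_add_mult:
  fixes F G :: "real \<times> real \<Rightarrow> 'a::real_normed_algebra"
  shows "\<lbrakk>(\<lambda>t. F (t, y)) differentiable at x; (\<lambda>t. G (t, y)) differentiable at x\<rbrakk> \<Longrightarrow>
      partial_x (\<lambda>p. F p + c * G p) (x, y) = partial_x F (x, y) + c * partial_x G (x, y)"
    and "\<lbrakk>(\<lambda>t. F (x, t)) differentiable at y; (\<lambda>t. G (x, t)) differentiable at y\<rbrakk> \<Longrightarrow>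
      partial_y (\<lambda>p. F p + c * G p) (x, y) = partial_y F (x, y) + c * partial_y G (x, y)"
proof -
  have "vector_derivative (\<lambda>t. f t + c * g t) (at a) =
      vector_derivative f (at a) + c * vector_derivative g (at a)"
    if "f differentiable at a" "g differentiable at a" for f g :: "real \<Rightarrow> 'a" and a
    using that by (intro vector_derivative_at has_vector_derivative_add
        has_vector_derivative_mult_right) (auto simp: vector_derivative_works)
  then show "\<lbrakk>(\<lambda>t. F (t, y)) differentiable at x; (\<lambda>t. G (t, y)) differentiable at x\<rbrakk> \<Longrightarrow>
      partial_x (\<lambda>p. F p + c * G p) (x, y) = partial_x F (x, y) + c * partial_x G (x, y)"
    and "\<lbrakk>(\<lambda>t. F (x, t)) differentiable at y; (\<lambda>t. G (x, t)) differentiable at y\<rbrakk> \<Longrightarrow>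
      partial_y (\<lambda>p. F p + c * G p) (x, y) = partial_y F (x, y) + c * partial_y G (x, y)"
    by (auto simp: partial_x_def partial_y_def)
qed

text \<open>Both \<open>\<alpha> + I \<beta>\<close> and the Cauchy--Riemann operator \<open>\<partial>\<^sub>x F + I \<partial>\<^sub>y F\<close> have this shape.\<close>

lemma Ck_on_add_mult:
  fixes F G :: "real \<times> real \<Rightarrow> 'a::real_normed_algebra"
  assumes "open S" and "Ck_on k S F" and "Ck_on k S G"
  shows "Ck_on k S (\<lambda>p. F p + c * G p)"
  using assms(2,3)
proof (induction k arbitrary: F G)
  case 0
  then show ?case by (auto intro!: continuous_intros)
next
  case (Suc k)
  have diff: "(\<lambda>t. F (t, y)) differentiable at x" "(\<lambda>t. G (t, y)) differentiable at x"
    "(\<lambda>t. F (x, t)) differentiable at y" "(\<lambda>t. G (x, t)) differentiable at y"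
    if "(x, y) \<in> S" for x y
    using Suc.prems that by auto
  have "Ck_on k S (\<lambda>p. partial_x F p + c * partial_x G p)"
    "Ck_on k S (\<lambda>p. partial_y F p + c * partial_y G p)"
    using Suc by auto
  then have "Ck_on k S (partial_x (\<lambda>p. F p + c * G p))" "Ck_on k S (partial_y (\<lambda>p. F p + c * G p))"
    by (auto intro: Ck_on_cong[OF assms(1), rotated] simp: partials_add_mult diff)
  moreover have "continuous_on S (\<lambda>p. F p + c * G p)"
    using Suc.prems by (auto intro!: continuous_intros)
  moreover have "(\<lambda>t. c * h t) differentiable at a"
    if "h differentiable at a" for h :: "real \<Rightarrow> 'a" and a
    using that unfolding differentiable_def by (blast intro: has_derivative_mult_right)
  ultimately show ?case
    using diff by (auto intro!: differentiable_add)
qed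

lemma Ck_on_cauchy_riemann_op:
  assumes "open S" and "Ck_on (Suc k) S F"
  shows "Ck_on k S (cauchy_riemann_op I F)"
  using assms Ck_on_add_mult[of S k "partial_x F" "partial_y F" I]
  by (simp add: cauchy_riemann_op_def)

lemma cauchy_riemann_op_cong:
  assumes "open S" and "\<And>p. p \<in> S \<Longrightarrow> F p = G p" and "p \<in> S"
  shows "cauchy_riemann_op I F p = cauchy_riemann_op I G p"
  using partials_cong(1,2)[OF assms(1,2)] assms(3)
  by (cases p) (simp add: cauchy_riemann_op_def)

lemma Ck_on_Suc_imp_C1: "Ck_on (Suc k) S F \<Longrightarrow> Ck_on 1 S F"
  by (cases k) auto

lemma has_derivative_of_C1:
  fixes F :: "real \<times> real \<Rightarrow> 'a::real_normed_vector"
  assumes "open S" and "Ck_on 1 S F" and "p \<in> S"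
  shows "(F has_derivative (\<lambda>h. fst h *\<^sub>R partial_x F p + snd h *\<^sub>R partial_y F p)) (at p)"
proof -
  have C1: "(\<lambda>t. F (t, v)) differentiable at u" "(\<lambda>t. F (u, t)) differentiable at v"
    if "(u, v) \<in> S" for u v
    using assms(2) that by auto
  have cont: "continuous_on S (partial_y F)"
    using assms(2) by simp
  obtain x y where p: "p = (x, y)" by (cases p)
  obtain A B where AB: "open A" "open B" "x \<in> A" "y \<in> B" "A \<times> B \<subseteq> S"
    by (rule open_prod_elim[OF assms(1,3)]) (simp add: p)
  \<comment> \<open>The joint derivative comes from a mean value argument in \<open>y\<close>, which needs a convex range.\<close>
  obtain e where e: "e > 0" "ball y e \<subseteq> B"
    using openE[OF AB(2,4)] by metis
  define Y where "Y = ball y e"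
  have Y: "open Y" "convex Y" "y \<in> Y" "A \<times> Y \<subseteq> S"
    using AB e by (auto simp: Y_def)
  have vx: "((\<lambda>t. F (t, v)) has_vector_derivative partial_x F (u, v)) (at u)"
    and vy: "((\<lambda>t. F (u, t)) has_vector_derivative partial_y F (u, v)) (at v)"
    if "u \<in> A" "v \<in> Y" for u v
    using C1 that Y(4) by (force simp: partial_x_def partial_y_def simp flip: vector_derivative_works)+
  have "((\<lambda>(u, v). F (u, v)) has_derivative
      (\<lambda>(tx, ty). tx *\<^sub>R partial_x F (x, y) +
        blinfun_apply (blinfun_scaleR_left (partial_y F (x, y))) ty)) (at (x, y) within A \<times> Y)"
  proof (rule has_derivative_partialsI[where
        fy = "\<lambda>u v. blinfun_scaleR_left (partial_y F (u, v))"])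
    show "((\<lambda>u. F (u, y)) has_derivative (\<lambda>t. t *\<^sub>R partial_x F (x, y))) (at x within A)"
      using vx[OF AB(3) Y(3)]
      by (simp add: has_vector_derivative_def has_derivative_at_withinI)
    show "((\<lambda>v. F (u, v)) has_derivative blinfun_apply (blinfun_scaleR_left (partial_y F (u, v))))
        (at v within Y)" if "u \<in> A" "v \<in> Y" for u v
      using vy[OF that] by (simp add: has_vector_derivative_def has_derivative_at_withinI)
    have "continuous_on (A \<times> Y) (partial_y F)"
      using cont Y(4) by (rule continuous_on_subset)
    then have "((\<lambda>q. blinfun_scaleR_left (partial_y F q)) \<longlongrightarrow> blinfun_scaleR_left (partial_y F (x, y)))
        (at (x, y) within A \<times> Y)"
      using AB Y by (intro bounded_linear.tendsto[OF bounded_linear_blinfun_scaleR_left])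
        (auto simp: continuous_on_def)
    then show "continuous (at (x, y) within A \<times> Y)
        (\<lambda>(u, v). blinfun_scaleR_left (partial_y F (u, v)))"
      by (simp add: continuous_within case_prod_unfold)
  qed (use AB Y in auto)
  moreover have "at (x, y) within A \<times> Y = at (x, y)"
    using AB Y by (intro at_within_open) (auto simp: open_Times)
  ultimately show ?thesis
    by (simp add: p case_prod_unfold)
qed

section \<open>The identity principle on one slice\<close>

lemma imag_unit_facts:
  assumes "I \<in> imag_units"
  shows "qRe I = 0" and "inner I I = 1" and "I * (I * q) = - q" and "- I \<in> imag_units"
proof -
  have I: "I * I = - 1"
    using assms by (simp add: imag_units_def power2_eq_square)
  then show "I * (I * q) = - q" "- I \<in> imag_units"
    by (simp_all add: mult.assoc[symmetric] imag_units_def power2_eq_square)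
  have n: "norm I = 1"
    using arg_cong[OF I, of norm] by (simp add: norm_mult square_eq_1_iff) (use norm_ge_zero[of I] in linarith)
  then show "inner I I = 1"
    by (simp add: dot_square_norm)
  \<comment> \<open>The real part of \<open>I\<^sup>2\<close> is \<open>2 (Re I)\<^sup>2 - |I|\<^sup>2\<close>.\<close>
  then have "2 * (qRe I * qRe I) = 0"
    using arg_cong[OF I, of qRe]
    unfolding inner_quat_def times_quat_def one_quat_def quat_sel_linear quat.sel by linarith
  then show "qRe I = 0" by simp
qed

text \<open>The order-one case. Testing against \<open>q \<mapsto> \<langle>q, v\<rangle> - \<i> \<langle>I q, v\<rangle>\<close> for every vector \<open>v\<close> avoids
  choosing a second unit \<open>J\<close> orthogonal to \<open>I\<close> and splitting \<open>F\<close> into two complex components.\<close>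

lemma identity_principle_order_one:
  assumes I: "I \<in> imag_units"
    and S: "open S" "connected S"
    and F: "Ck_on 1 S F" and G: "Ck_on 1 S G"
    and CR: "\<And>p. p \<in> S \<Longrightarrow> cauchy_riemann_op I F p = cauchy_riemann_op I G p"
    and V: "open V" "V \<noteq> {}" "V \<subseteq> S" and eq: "\<And>p. p \<in> V \<Longrightarrow> F p = G p"
    and p: "p \<in> S"
  shows "F p = G p"
proof -
  define plane :: "complex \<Rightarrow> real \<times> real" where "plane z = (Re z, Im z)" for z
  define S' V' where "S' = plane -` S" and "V' = plane -` V"
  have plane_Complex: "plane (Complex x y) = (x, y)" for x y
    by (simp add: plane_def)
  have plane_deriv: "(plane has_derivative plane) (at z)" for z
    unfolding plane_def[abs_def] by (auto intro!: derivative_eq_intros)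
  have "continuous_on UNIV plane"
    unfolding plane_def[abs_def] by (intro continuous_intros)
  then have open': "open S'" "open V'"
    using S V by (auto simp: S'_def V'_def intro: open_vimage)
  have "S' = (\<lambda>(x, y). Complex x y) ` S"
    by (force simp: S'_def plane_def image_iff complex_eq_iff)
  moreover have "continuous_on S (\<lambda>(x, y). Complex x y)"
    unfolding case_prod_unfold Complex_eq by (intro continuous_intros)
  ultimately have conn': "connected S'"
    using S(2) connected_continuous_image by metis
  have V'ne: "V' \<noteq> {}"
    using V(2) plane_Complex by (force simp: V'_def)
  have "inner (F p - G p) v = 0" for v
  proof -
    define \<phi> where "\<phi> q = Complex (inner q v) (- inner (I * q) v)" for q
    have \<phi>_eq: "\<phi> q = complex_of_real (inner q v) - \<i> * complex_of_real (inner (I * q) v)" for q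
      by (simp add: \<phi>_def complex_eq_iff)
    have lin: "bounded_linear \<phi>"
      unfolding \<phi>_eq[abs_def]
      by (intro bounded_linear_intros bounded_linear_compose[OF bounded_linear_of_real]
          bounded_linear_compose[OF bounded_linear_inner_left] bounded_linear_sub
          bounded_linear_compose[OF bounded_linear_mult_right] bounded_linear_ident)
    have \<phi>_mult: "\<phi> (I * q) = \<i> * \<phi> q" for q
      using imag_unit_facts(3)[OF I] by (simp add: \<phi>_def complex_eq_iff)
    define H where "H = (\<lambda>z. \<phi> (F (plane z) - G (plane z)))"
    have "(H has_field_derivative \<phi> (partial_x F (plane z) - partial_x G (plane z))) (at z)"
      if "z \<in> S'" for z
    proof -
      define a b where "a = partial_x F (plane z) - partial_x G (plane z)"
        and "b = partial_y F (plane z) - partial_y G (plane z)"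
      have z: "plane z \<in> S"
        using that by (simp add: S'_def)
      have "((\<lambda>q. F q - G q) has_derivative (\<lambda>h. fst h *\<^sub>R a + snd h *\<^sub>R b)) (at (plane z))"
        using has_derivative_diff[OF has_derivative_of_C1[OF S(1) F z]
            has_derivative_of_C1[OF S(1) G z]]
        by (simp add: a_def b_def algebra_simps)
      from has_derivative_compose[OF plane_deriv this]
      have "(H has_derivative (\<lambda>h. \<phi> (Re h *\<^sub>R a + Im h *\<^sub>R b))) (at z)"
        unfolding H_def using bounded_linear.has_derivative[OF lin] by (simp add: plane_def)
      moreover have "\<phi> (Re h *\<^sub>R a + Im h *\<^sub>R b) = \<phi> a * h" for h
      proof -
        have "a = - (I * b)"
          using CR[OF z]
          by (simp add: a_def b_def cauchy_riemann_op_def algebra_simps eq_neg_iff_add_eq_0)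
        then have "I * a = b"
          using imag_unit_facts(3)[OF I] by simp
        then have "\<phi> b = \<i> * \<phi> a"
          using \<phi>_mult by metis
        moreover have "\<phi> (Re h *\<^sub>R a + Im h *\<^sub>R b) = Re h *\<^sub>R \<phi> a + Im h *\<^sub>R \<phi> b"
          using lin by (simp add: linear_simps)
        ultimately show ?thesis
          by (simp add: complex_eq_iff algebra_simps)
      qed
      ultimately show ?thesis
        by (simp add: has_field_derivative_def a_def)
    qed
    then have "H holomorphic_on S'"
      using open' by (auto simp: holomorphic_on_open)
    moreover have "H z = 0" if "z \<in> V'" for z
      using that eq linear_0[OF bounded_linear.linear[OF lin]] by (simp add: H_def V'_def)
    moreover have "V' \<subseteq> S'"
      using V(3) by (auto simp: S'_def V'_def)
    moreover have pz: "plane (Complex (fst p) (snd p)) = p"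
      by (simp add: plane_Complex)
    then have "Complex (fst p) (snd p) \<in> S'"
      using p by (simp add: S'_def)
    ultimately have "H (Complex (fst p) (snd p)) = 0"
      using analytic_continuation_open[of V' S' H "\<lambda>_. 0"] open' conn' V'ne by auto
    then show ?thesis
      unfolding H_def pz by (simp add: \<phi>_def complex_eq_iff)
  qed
  from this[of "F p - G p"] show ?thesis by simp
qed

text \<open>Comparing two functions with the same image under the iterated operator, instead of asking
  when one solution vanishes, means that the operator never has to be applied to a difference.\<close>

lemma identity_principle_polyanalytic:
  assumes I: "I \<in> imag_units"
    and S: "open S" "connected S"
    and V: "open V" "V \<noteq> {}" "V \<subseteq> S"
    and "Ck_on N S F" and "Ck_on N S G"
    and "\<And>p. p \<in> S \<Longrightarrow> (cauchy_riemann_op I ^^ N) F p = (cauchy_riemann_op I ^^ N) G p"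
    and "\<And>p. p \<in> V \<Longrightarrow> F p = G p"
    and "p \<in> S"
  shows "F p = G p"
  using assms(7-)
proof (induction N arbitrary: F G p)
  case 0
  then show ?case by simp
next
  case (Suc N)
  have "cauchy_riemann_op I F q = cauchy_riemann_op I G q" if "q \<in> S" for q
  proof (rule Suc.IH)
    show "Ck_on N S (cauchy_riemann_op I F)" "Ck_on N S (cauchy_riemann_op I G)"
      using Ck_on_cauchy_riemann_op S(1) Suc.prems(1,2) by blast+
    show "(cauchy_riemann_op I ^^ N) (cauchy_riemann_op I F) r =
        (cauchy_riemann_op I ^^ N) (cauchy_riemann_op I G) r" if "r \<in> S" for r
      using Suc.prems(3)[OF that] by (simp add: funpow_swap1)
    show "cauchy_riemann_op I F r = cauchy_riemann_op I G r" if "r \<in> V" for r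
      using cauchy_riemann_op_cong[OF V(1) _ that] Suc.prems(4) by blast
  qed fact
  then show ?case
    using identity_principle_order_one[OF I S _ _ _ V] Suc.prems Ck_on_Suc_imp_C1 by blast
qed

section \<open>The geometry of axially symmetric slice domains\<close>

definition slice_point :: "quat \<Rightarrow> real \<times> real \<Rightarrow> quat" where
  "slice_point I p = of_real (fst p) + I * of_real (snd p)"

lemma continuous_slice_point: "continuous_on A (slice_point I)"
  unfolding slice_point_def[abs_def] by (intro continuous_intros)

lemma slice_point_coords:
  assumes "I \<in> imag_units"
  shows "(inner (slice_point I p) 1, inner (slice_point I p) I) = p"
proof -
  have "of_real r = Quat r 0 0 0" for r
    by (simp add: of_real_def scaleR_quat_def one_quat_def)
  then have "slice_point I p = fst p *\<^sub>R 1 + snd p *\<^sub>R I"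
    by (simp add: slice_point_def times_quat_def one_quat_def quat_eq_iff)
  moreover have "inner 1 I = 0" "inner I 1 = 0" "inner (1 :: quat) 1 = 1"
    using imag_unit_facts(1)[OF assms] by (simp_all add: inner_quat_def one_quat_def)
  ultimately show ?thesis
    using imag_unit_facts(2)[OF assms] by (simp add: inner_add_left)
qed

lemma slice_plane_eq: "slice_plane I = range (slice_point I)"
  by (auto simp: slice_plane_def slice_point_def image_iff; blast)

lemma param_set_eq:
  assumes "axially_symmetric \<Omega>" and "I \<in> imag_units"
  shows "param_set \<Omega> = slice_point I -` \<Omega>"
  using assms by (fastforce simp: param_set_def axially_symmetric_def slice_point_def)

lemma open_param_set:
  assumes "axially_symmetric \<Omega>" and "open \<Omega>" and "I \<in> imag_units"
  shows "open (param_set \<Omega>)"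
  unfolding param_set_eq[OF assms(1,3)] using assms(2) continuous_slice_point by (rule open_vimage)

lemma connected_param_set:
  assumes "axially_symmetric \<Omega>" and "I \<in> imag_units" and "connected (slice \<Omega> I)"
  shows "connected (param_set \<Omega>)"
proof -
  have "slice \<Omega> I = slice_point I ` param_set \<Omega>"
    by (auto simp: param_set_eq[OF assms(1,2)] slice_def slice_plane_eq)
  then have "param_set \<Omega> = (\<lambda>q. (inner q 1, inner q I)) ` slice \<Omega> I"
    using slice_point_coords[OF assms(2)] by (simp add: image_image del: split_paired_All)
  moreover have "continuous_on (slice \<Omega> I) (\<lambda>q. (inner q 1, inner q I))"
    by (intro continuous_intros)
  ultimately show ?thesis
    using assms(3) connected_continuous_image by metis
qed

lemma open_vimage_slice_point:
  assumes "openin (top_of_set (slice_plane I)) U"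
  shows "open (slice_point I -` U)"
proof -
  obtain T where T: "open T" "U = slice_plane I \<inter> T"
    using assms by (auto simp: openin_open)
  then have "slice_point I -` U = slice_point I -` T"
    by (auto simp: slice_plane_eq)
  then show ?thesis
    using T(1) continuous_slice_point by (auto intro: open_vimage)
qed

lemma quat_in_some_slice:
  obtains J p where "J \<in> imag_units" and "q = slice_point J p"
proof -
  define w where "w = Quat 0 (qI q) (qJ q) (qK q)"
  define n where "n = (qI q)\<^sup>2 + (qJ q)\<^sup>2 + (qK q)\<^sup>2"
  have q: "q = of_real (qRe q) + w"
    by (simp add: w_def quat_eq_iff of_real_def one_quat_def)
  have w2: "w * w = - (n *\<^sub>R 1)"
    by (simp add: w_def n_def times_quat_def one_quat_def quat_eq_iff power2_eq_square)
  have "n \<ge> 0"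
    by (simp add: n_def)
  show ?thesis
  proof (cases "n = 0")
    case True
    \<comment> \<open>A real quaternion lies in every slice.\<close>
    then have "w * w = 0"
      using w2 by simp
    then have "q = slice_point (Quat 0 1 0 0) (qRe q, 0)"
      using q by (simp add: slice_point_def)
    moreover have "Quat 0 1 0 0 \<in> imag_units"
      by (simp add: imag_units_def power2_eq_square times_quat_def one_quat_def quat_eq_iff)
    ultimately show ?thesis using that by blast
  next
    case False
    define J where "J = w /\<^sub>R sqrt n"
    have "J * J = - 1"
      using False \<open>n \<ge> 0\<close> w2 by (simp add: J_def field_simps)
    moreover have "q = slice_point J (qRe q, sqrt n)"
      using q False \<open>n \<ge> 0\<close> by (simp add: slice_point_def J_def of_real_def)
    ultimately show ?thesis
      using that by (auto simp: imag_units_def power2_eq_square)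
  qed
qed

text \<open>At \<open>(x, -y)\<close> the restriction to the slice of \<open>I\<close> takes the value \<open>\<alpha> - I \<beta>\<close>, so its values at
  \<open>(x, y)\<close> and \<open>(x, -y)\<close> together recover \<open>\<alpha>\<close> and \<open>\<beta>\<close>.\<close>

lemma slice_components_unique:
  assumes "axially_symmetric \<Omega>" and I: "I \<in> imag_units"
    and f: "slice_components \<Omega> f \<alpha> \<beta>" and g: "slice_components \<Omega> g \<gamma> \<delta>"
    and eq: "\<And>p. p \<in> param_set \<Omega> \<Longrightarrow> \<alpha> p + I * \<beta> p = \<gamma> p + I * \<delta> p"
    and p: "(x, y) \<in> param_set \<Omega>"
  shows "\<alpha> (x, y) = \<gamma> (x, y)" and "\<beta> (x, y) = \<delta> (x, y)"
proof -
  have "(x, -y) \<in> param_set \<Omega>"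
    using p imag_unit_facts(4) by (force simp: param_set_def)
  from eq[OF this] have "\<alpha> (x, y) - I * \<beta> (x, y) = \<gamma> (x, y) - I * \<delta> (x, y)"
    using f g p unfolding slice_components_def by fastforce
  note m = this eq[OF p]
  have "2 *\<^sub>R \<alpha> (x, y) = 2 *\<^sub>R \<gamma> (x, y)"
    using arg_cong2[OF m(1) m(2), of "(+)"] by (simp add: scaleR_2)
  then show "\<alpha> (x, y) = \<gamma> (x, y)" by simp
  then have "I * \<beta> (x, y) = I * \<delta> (x, y)"
    using m(2) by simp
  moreover have "I \<noteq> 0"
    using imag_unit_facts(2)[OF I] by auto
  ultimately show "\<beta> (x, y) = \<delta> (x, y)" by simp
qed

section \<open>The identity principle\<close>

theorem theorem3p8:
  fixes f g :: "quat \<Rightarrow> quat" and \<Omega> U :: "quat set" and I :: quat and N :: nat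
  assumes "N \<ge> 1"
    and "axially_symmetric \<Omega>" and "slice_domain \<Omega>"
    and "slice_polyanalytic N \<Omega> f" and "slice_polyanalytic N \<Omega> g"
    and "I \<in> imag_units"
    and "U \<subseteq> slice \<Omega> I" and "domain_in (slice_plane I) U"
    and "\<forall>q\<in>U. f q = g q"
  shows "\<forall>q\<in>\<Omega>. f q = g q"
proof -
  note sym = assms(2) and I = assms(6)
  have "open \<Omega>" "connected (slice \<Omega> I)"
    using assms(3) I by (auto simp: slice_domain_def domain_in_def)
  then have S: "open (param_set \<Omega>)" "connected (param_set \<Omega>)"
    using open_param_set connected_param_set sym I by blast+
  obtain \<alpha> \<beta> where f: "slice_components \<Omega> f \<alpha> \<beta>"
    "Ck_on N (param_set \<Omega>) \<alpha>" "Ck_on N (param_set \<Omega>) \<beta>"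
    "\<And>p. p \<in> param_set \<Omega> \<Longrightarrow> (cauchy_riemann_op I ^^ N) (\<lambda>p. \<alpha> p + I * \<beta> p) p = 0"
    using assms(4) I unfolding slice_polyanalytic_def by fastforce
  obtain \<gamma> \<delta> where g: "slice_components \<Omega> g \<gamma> \<delta>"
    "Ck_on N (param_set \<Omega>) \<gamma>" "Ck_on N (param_set \<Omega>) \<delta>"
    "\<And>p. p \<in> param_set \<Omega> \<Longrightarrow> (cauchy_riemann_op I ^^ N) (\<lambda>p. \<gamma> p + I * \<delta> p) p = 0"
    using assms(5) I unfolding slice_polyanalytic_def by fastforce
  have val: "f (slice_point J p) = \<alpha> p + J * \<beta> p" "g (slice_point J p) = \<gamma> p + J * \<delta> p"
    if "J \<in> imag_units" "slice_point J p \<in> \<Omega>" for J p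
    using f(1) g(1) that by (auto simp: slice_components_def slice_point_def)
  define V where "V = slice_point I -` U"
  have "open V"
    using assms(8) open_vimage_slice_point by (simp add: V_def domain_in_def)
  moreover have "V \<noteq> {}" "V \<subseteq> param_set \<Omega>"
    using assms(7,8)
    by (auto simp: V_def domain_in_def slice_def slice_plane_eq param_set_eq[OF sym I])
  ultimately have V: "open V" "V \<noteq> {}" "V \<subseteq> param_set \<Omega>" .
  have "\<alpha> p + I * \<beta> p = \<gamma> p + I * \<delta> p" if "p \<in> param_set \<Omega>" for p
  proof (rule identity_principle_polyanalytic[OF I S V, where N = N])
    show "Ck_on N (param_set \<Omega>) (\<lambda>p. \<alpha> p + I * \<beta> p)" "Ck_on N (param_set \<Omega>) (\<lambda>p. \<gamma> p + I * \<delta> p)"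
      using Ck_on_add_mult S(1) f g by blast+
    show "\<alpha> q + I * \<beta> q = \<gamma> q + I * \<delta> q" if "q \<in> V" for q
    proof -
      have "slice_point I q \<in> \<Omega>" "f (slice_point I q) = g (slice_point I q)"
        using that assms(7,9) by (auto simp: V_def slice_def)
      then show ?thesis
        using val[OF I] by simp
    qed
  qed (simp_all add: f g that)
  then have "\<alpha> p = \<gamma> p" "\<beta> p = \<delta> p" if "p \<in> param_set \<Omega>" for p
    using slice_components_unique[OF sym I f(1) g(1)] that by (cases p; blast)+
  then show ?thesis
    using val param_set_eq[OF sym] by (metis quat_in_some_slice vimageI)
qed

end
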